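(* For $i\in\mathbb{N}$ let $A^{\downarrow\uparrow}_i=-x\otimes(-t)^i$, $B^{\downarrow\uparrow}_i=(y\otimes t+z\otimes(t-1))(-t)^i$, $\psi^{\downarrow\uparrow}_{i+1}=-y\otimes(-t)^{i+1}$; these elements form a basis, denoted $[0321]$, of the Onsager Lie algebra $O$. The basis $[0321]$ is recursively obtained in the order $$A^{\downarrow\uparrow}_0,\ B^{\downarrow\uparrow}_0,\ \psi^{\downarrow\uparrow}_1,\ A^{\downarrow\uparrow}_1,\ B^{\downarrow\uparrow}_1,\ \psi^{\downarrow\uparrow}_2,\ A^{\downarrow\uparrow}_2,\ B^{\downarrow\uparrow}_2,\ \psi^{\downarrow\uparrow}_3,\ \ldots$$ using $A^{\downarrow\uparrow}_0=-A$, $B^{\downarrow\uparrow}_0=B$ and the following equations for $i\geq1$: $$\begin{aligned} \psi^{\downarrow\uparrow}_i&=\frac{A^{\downarrow\uparrow}_{i-1}}{2}+\frac{B^{\downarrow\uparrow}_{i-1}}{2}-\frac{[A^{\downarrow\uparrow}_{i-1},B]}{4},\\ A^{\downarrow\uparrow}_i&=-\frac{[\psi^{\downarrow\uparrow}_i,A]}{2}-\psi^{\downarrow\uparrow}_i,\\ B^{\downarrow\uparrow}_i&=\frac{[B,\psi^{\downarrow\uparrow}_i]}{2}-\psi^{\downarrow\uparrow}_i. \end{aligned}$$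
   Context: $\mathbb{F}$ is a field of characteristic zero; $\mathbb{N}=\{0,1,2,\ldots\}$; tensor products are over $\mathbb{F}$. $\mathfrak{sl}_2$ is the Lie algebra over $\mathbb{F}$ with basis $e,f,h$ and $[h,e]=2e$, $[h,f]=-2f$, $[e,f]=h$. Its equitable basis is $x=2e-h$, $y=-2f-h$, $z=h$, which satisfies $[x,y]=2x+2y$, $[y,z]=2y+2z$, $[z,x]=2z+2x$. Let $t$ be an indeterminate and $\mathcal{A}=\mathbb{F}[t,t^{-1},(t-1)^{-1}]$. The three-point $\mathfrak{sl}_2$ loop algebra $L(\mathfrak{sl}_2)^+$ is the vector space $\mathfrak{sl}_2\otimes\mathcal{A}$ with Lie bracket $[u\otimes a,v\otimes b]=[u,v]\otimes ab$. It is a right $\mathcal{A}$-module via $(u\otimes a)b=u\otimes ab$. The Onsager Lie algebra $O$ (generators $A,B$; relations $[A,[A,[A,B]]]=4[A,B]$, $[B,[B,[B,A]]]=4[B,A]$) is identified with the Lie subalgebra of $L(\mathfrak{sl}_2)^+$ generated by $A=x\otimes1$ and $B=y\otimes t+z\otimes(t-1)$. *)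

theory Defs
  imports "HOL-Computational_Algebra.Computational_Algebra"
begin

text \<open>The algebra $\mathcal A = F[t,t^{-1},(t-1)^{-1}]$ is realised inside the field $F(t)$ of
  rational functions as the set of all fractions $p/(t^m (t-1)^n)$.\<close>

definition three_point_carrier :: "'a::field poly fract set" where
  "three_point_carrier = {Fract p ([:0, 1:] ^ m * [:-1, 1:] ^ n) | p m n. True}"

lemma denom_nonzero: "[:0, 1:] ^ m * [:-1, 1:] ^ n \<noteq> (0 :: 'a::field poly)"
  by simp

lemma three_point_carrierI:
  "Fract p ([:0, 1:] ^ m * [:-1, 1:] ^ n) \<in> three_point_carrier"
  unfolding three_point_carrier_def by blast

lemma three_point_carrierE:
  assumes "x \<in> three_point_carrier"
  obtains p m n where "x = Fract p ([:0, 1:] ^ m * [:-1, 1:] ^ n)"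
  using assms unfolding three_point_carrier_def by blast

lemma three_point_carrier_poly: "Fract p 1 \<in> three_point_carrier"
  using three_point_carrierI[of p 0 0] by simp

lemma three_point_carrier_mult:
  assumes "x \<in> three_point_carrier" "y \<in> three_point_carrier"
  shows "x * y \<in> three_point_carrier"
proof -
  from assms(1) obtain p m n where x: "x = Fract p ([:0, 1:] ^ m * [:-1, 1:] ^ n)"
    by (rule three_point_carrierE)
  from assms(2) obtain q k l where y: "y = Fract q ([:0, 1:] ^ k * [:-1, 1:] ^ l)"
    by (rule three_point_carrierE)
  have "x * y = Fract (p * q) ([:0, 1:] ^ (m + k) * [:-1, 1:] ^ (n + l))"
    by (simp add: x y power_add mult_ac)
  then show ?thesis by (simp only: three_point_carrierI)
qed

lemma three_point_carrier_add:
  assumes "x \<in> three_point_carrier" "y \<in> three_point_carrier"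
  shows "x + y \<in> three_point_carrier"
proof -
  from assms(1) obtain p m n where x: "x = Fract p ([:0, 1:] ^ m * [:-1, 1:] ^ n)"
    by (rule three_point_carrierE)
  from assms(2) obtain q k l where y: "y = Fract q ([:0, 1:] ^ k * [:-1, 1:] ^ l)"
    by (rule three_point_carrierE)
  have "x + y = Fract (p * ([:0, 1:] ^ k * [:-1, 1:] ^ l) + q * ([:0, 1:] ^ m * [:-1, 1:] ^ n))
      ([:0, 1:] ^ (m + k) * [:-1, 1:] ^ (n + l))"
    unfolding x y add_fract[OF denom_nonzero denom_nonzero] by (simp only: power_add mult_ac)
  then show ?thesis by (simp only: three_point_carrierI)
qed

lemma three_point_carrier_uminus:
  "x \<in> three_point_carrier \<Longrightarrow> - x \<in> three_point_carrier"
  by (auto simp: three_point_carrier_def) metis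

typedef (overloaded) ('a::field) three_point = "three_point_carrier :: 'a poly fract set"
  using three_point_carrier_poly by blast

setup_lifting type_definition_three_point

instantiation three_point :: (field) comm_ring_1
begin

lift_definition zero_three_point :: "'a three_point" is 0
  using three_point_carrier_poly[of 0] by (simp add: fract_collapse)
lift_definition one_three_point :: "'a three_point" is 1
  using three_point_carrier_poly[of 1] by (simp add: fract_collapse)
lift_definition plus_three_point :: "'a three_point \<Rightarrow> 'a three_point \<Rightarrow> 'a three_point" is "(+)"
  by (rule three_point_carrier_add)
lift_definition times_three_point :: "'a three_point \<Rightarrow> 'a three_point \<Rightarrow> 'a three_point" is "(*)"
  by (rule three_point_carrier_mult)
lift_definition uminus_three_point :: "'a three_point \<Rightarrow> 'a three_point" is uminus
  by (rule three_point_carrier_uminus)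
lift_definition minus_three_point :: "'a three_point \<Rightarrow> 'a three_point \<Rightarrow> 'a three_point" is "(-)"
  using three_point_carrier_add three_point_carrier_uminus
  by (metis add_uminus_conv_diff)

instance
  by standard (transfer; simp add: algebra_simps)+

end

lift_definition tp_const :: "'a::field \<Rightarrow> 'a three_point" is "\<lambda>c. Fract [:c:] 1"
  by (rule three_point_carrier_poly)

lift_definition tvar :: "'a::field three_point" is "Fract [:0, 1:] 1"
  by (rule three_point_carrier_poly)

lemma tp_const_simps [simp]:
  fixes a b :: "'a::field"
  shows "tp_const 0 = (0 :: 'a three_point)" "tp_const 1 = (1 :: 'a three_point)"
  "tp_const (a + b) = tp_const a + tp_const b"
  "tp_const (a * b) = tp_const a * tp_const b"
proof -
  show "tp_const 0 = (0 :: 'a three_point)" by transfer (simp add: Zero_fract_def)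
  show "tp_const 1 = (1 :: 'a three_point)" by transfer (simp add: One_fract_def one_pCons)
  show "tp_const (a + b) = tp_const a + tp_const b" by transfer simp
  show "tp_const (a * b) = tp_const a * tp_const b"
    by transfer (simp add: mult.commute)
qed

lemma tp_const_uminus [simp]: "tp_const (- a) = - tp_const a"
  by (metis add.right_inverse add_eq_0_iff tp_const_simps(1,3))

lemma tp_const_diff [simp]: "tp_const (a - b) = tp_const a - tp_const b"
  using tp_const_simps(3)[of a "- b"] by simp

lemma tp_const_of_nat [simp]: "tp_const (of_nat n) = of_nat n"
  by (induction n) simp_all

lemma tp_const_numeral [simp]: "tp_const (numeral n) = numeral n"
  using tp_const_of_nat[of "numeral n"] by simp

lift_definition tvar_inv :: "'a::field three_point" is "Fract 1 [:0, 1:]"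
  using three_point_carrierI[of 1 1 0] by simp

lift_definition tvar_minus_1_inv :: "'a::field three_point" is "Fract 1 [:-1, 1:]"
  using three_point_carrierI[of 1 0 1] by simp

lemma tvar_inv: "tvar * tvar_inv = 1"
  by transfer (simp add: One_fract_def eq_fract)

lemma tvar_minus_1_inv: "(tvar - 1) * tvar_minus_1_inv = 1"
  by transfer (simp add: One_fract_def eq_fract one_pCons)

text \<open>\<open>Sl2 a b c\<close> stands for $a e + b f + c h$.\<close>

datatype 'r sl2 = Sl2 (coeff_e: 'r) (coeff_f: 'r) (coeff_h: 'r)

instantiation sl2 :: (ab_group_add) ab_group_add
begin

definition "0 = Sl2 0 0 0"
definition "u + v = Sl2 (coeff_e u + coeff_e v) (coeff_f u + coeff_f v) (coeff_h u + coeff_h v)"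
definition "u - v = Sl2 (coeff_e u - coeff_e v) (coeff_f u - coeff_f v) (coeff_h u - coeff_h v)"
definition "- u = Sl2 (- coeff_e u) (- coeff_f u) (- coeff_h u)"

instance
  by standard
    (simp_all add: zero_sl2_def plus_sl2_def minus_sl2_def uminus_sl2_def algebra_simps)

end

lemmas sl2_defs = zero_sl2_def plus_sl2_def minus_sl2_def uminus_sl2_def

definition sl2_smult :: "'r::comm_ring_1 \<Rightarrow> 'r sl2 \<Rightarrow> 'r sl2" where
  "sl2_smult r u = Sl2 (r * coeff_e u) (r * coeff_f u) (r * coeff_h u)"

text \<open>The bilinear alternating extension of $[h,e]=2e$, $[h,f]=-2f$, $[e,f]=h$.\<close>

definition bracket :: "'r::comm_ring_1 sl2 \<Rightarrow> 'r sl2 \<Rightarrow> 'r sl2" ("\<lbrakk>_, _\<rbrakk>") where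
  "\<lbrakk>u, v\<rbrakk> = Sl2
     (2 * (coeff_h u * coeff_e v - coeff_e u * coeff_h v))
     (2 * (coeff_f u * coeff_h v - coeff_h u * coeff_f v))
     (coeff_e u * coeff_f v - coeff_f u * coeff_e v)"

definition sl2_e :: "'r::comm_ring_1 sl2" where "sl2_e = Sl2 1 0 0"
definition sl2_f :: "'r::comm_ring_1 sl2" where "sl2_f = Sl2 0 1 0"
definition sl2_h :: "'r::comm_ring_1 sl2" where "sl2_h = Sl2 0 0 1"

definition sl2_x :: "'r::comm_ring_1 sl2" where "sl2_x = sl2_smult 2 sl2_e - sl2_h"
definition sl2_y :: "'r::comm_ring_1 sl2" where "sl2_y = sl2_smult (-2) sl2_f - sl2_h"
definition sl2_z :: "'r::comm_ring_1 sl2" where "sl2_z = sl2_h"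

lemmas sl2_basis_defs = sl2_e_def sl2_f_def sl2_h_def sl2_x_def sl2_y_def sl2_z_def sl2_smult_def

lemma sl2_brackets:
  "\<lbrakk>sl2_h, sl2_e\<rbrakk> = sl2_smult 2 sl2_e"
  "\<lbrakk>sl2_h, sl2_f\<rbrakk> = sl2_smult (-2) sl2_f"
  "\<lbrakk>sl2_e, sl2_f\<rbrakk> = sl2_h"
  by (simp_all add: bracket_def sl2_basis_defs)

lemma equitable_brackets:
  "\<lbrakk>sl2_x, sl2_y\<rbrakk> = sl2_smult 2 sl2_x + sl2_smult 2 sl2_y"
  "\<lbrakk>sl2_y, sl2_z\<rbrakk> = sl2_smult 2 sl2_y + sl2_smult 2 sl2_z"
  "\<lbrakk>sl2_z, sl2_x\<rbrakk> = sl2_smult 2 sl2_z + sl2_smult 2 sl2_x"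
  by (simp_all add: bracket_def sl2_basis_defs sl2_defs)

lemma bracket_self: "\<lbrakk>u, u\<rbrakk> = 0"
  by (simp add: bracket_def sl2_defs mult.commute)

lemma bracket_jacobi: "\<lbrakk>u, \<lbrakk>v, w\<rbrakk>\<rbrakk> + \<lbrakk>v, \<lbrakk>w, u\<rbrakk>\<rbrakk> + \<lbrakk>w, \<lbrakk>u, v\<rbrakk>\<rbrakk> = 0"
  by (simp add: bracket_def sl2_defs algebra_simps)

global_interpretation sl2: vector_space "sl2_smult :: 'a::field \<Rightarrow> 'a sl2 \<Rightarrow> 'a sl2"
  by standard (simp_all add: sl2_smult_def sl2_defs algebra_simps)

lemma three_point_vector_space: "vector_space (\<lambda>(c::'a::field) a. tp_const c * a)"
  by standard (simp_all add: algebra_simps)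

text \<open>The space $\mathfrak{sl}_2 \otimes \mathcal A$ is realised by extension of scalars: since
  $e,f,h$ is a basis of $\mathfrak{sl}_2$, every element is uniquely of the form
  $e\otimes a + f\otimes b + h\otimes c$, which is represented by \<open>Sl2 a b c\<close>. That this is the
  tensor product, and that \<open>bracket\<close> is the prescribed Lie bracket, is the content of
  \<open>tensor_universal\<close>, \<open>bracket_tensor\<close> and \<open>bracket_linear\<close>.\<close>

type_synonym 'a loop = "'a three_point sl2"

definition tensor :: "'a::field sl2 \<Rightarrow> 'a three_point \<Rightarrow> 'a loop" (infixl "\<otimes>" 72) where
  "u \<otimes> a = Sl2 (tp_const (coeff_e u) * a) (tp_const (coeff_f u) * a) (tp_const (coeff_h u) * a)"

definition loop_scale :: "'a::field \<Rightarrow> 'a loop \<Rightarrow> 'a loop" (infixr "*\<^sub>L" 75) where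
  "c *\<^sub>L u = sl2_smult (tp_const c) u"

definition loop_act :: "'a::field loop \<Rightarrow> 'a three_point \<Rightarrow> 'a loop" (infixl "\<cdot>" 72) where
  "u \<cdot> b = Sl2 (coeff_e u * b) (coeff_f u * b) (coeff_h u * b)"

global_interpretation loop: vector_space "loop_scale :: 'a::field \<Rightarrow> 'a loop \<Rightarrow> 'a loop"
  by standard (simp_all add: loop_scale_def sl2_smult_def sl2_defs algebra_simps)

lemma loop_act_tensor: "(u \<otimes> a) \<cdot> b = u \<otimes> (a * b)"
  by (simp add: loop_act_def tensor_def mult.assoc)

lemma bracket_tensor: "\<lbrakk>u \<otimes> a, v \<otimes> b\<rbrakk> = \<lbrakk>u, v\<rbrakk> \<otimes> (a * b)"
  by (simp add: bracket_def tensor_def algebra_simps)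

lemma bracket_linear:
  "Vector_Spaces.linear loop_scale loop_scale (\<lambda>u. \<lbrakk>u, v\<rbrakk>)"
  "Vector_Spaces.linear loop_scale loop_scale (\<lambda>u. \<lbrakk>v, u\<rbrakk>)"
  by (standard; simp add: bracket_def loop_scale_def sl2_smult_def sl2_defs algebra_simps)+

lemma tensor_linear:
  "Vector_Spaces.linear sl2_smult loop_scale (\<lambda>u. u \<otimes> a)"
  "Vector_Spaces.linear (\<lambda>c a. tp_const c * a) loop_scale (\<lambda>a. u \<otimes> a)"
  by (standard; simp add: tensor_def loop_scale_def sl2_smult_def sl2_defs algebra_simps)+

lemma loop_decompose: "w = sl2_e \<otimes> coeff_e w + sl2_f \<otimes> coeff_f w + sl2_h \<otimes> coeff_h w"
  by (cases w) (simp add: tensor_def sl2_e_def sl2_f_def sl2_h_def sl2_defs)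

lemma sl2_decompose:
  "u = sl2_smult (coeff_e u) sl2_e + sl2_smult (coeff_f u) sl2_f + sl2_smult (coeff_h u) sl2_h"
  by (cases u) (simp add: sl2_smult_def sl2_e_def sl2_f_def sl2_h_def sl2_defs)

lemma tensor_universal:
  fixes \<beta> :: "'a::field sl2 \<Rightarrow> 'a three_point \<Rightarrow> 'v::ab_group_add"
  assumes "vector_space s"
    and lin1: "\<And>a. Vector_Spaces.linear sl2_smult s (\<lambda>u. \<beta> u a)"
    and lin2: "\<And>u. Vector_Spaces.linear (\<lambda>c a. tp_const c * a) s (\<beta> u)"
  shows "\<exists>!g. Vector_Spaces.linear loop_scale s g \<and> (\<forall>u a. g (u \<otimes> a) = \<beta> u a)"
proof (rule ex1I)
  interpret V: vector_space s by fact
  let ?g = "\<lambda>w. \<beta> sl2_e (coeff_e w) + \<beta> sl2_f (coeff_f w) + \<beta> sl2_h (coeff_h w)"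
  have a1: "\<beta> (u + v) a = \<beta> u a + \<beta> v a" and s1: "\<beta> (sl2_smult c u) a = s c (\<beta> u a)" for u v a c
    using lin1[of a] by (auto simp: Vector_Spaces.linear_iff)
  have a2: "\<beta> u (a + b) = \<beta> u a + \<beta> u b" and s2: "\<beta> u (tp_const c * a) = s c (\<beta> u a)" for u a b c
    using lin2[of u] by (auto simp: Vector_Spaces.linear_iff)
  have "Vector_Spaces.linear loop_scale s ?g"
    unfolding Vector_Spaces.linear_iff
    using loop.vector_space_axioms V.vector_space_axioms
    by (simp add: a2 s2 loop_scale_def sl2_smult_def plus_sl2_def V.scale_right_distrib)
  moreover have "?g (u \<otimes> a) = \<beta> u a" for u a
  proof -
    have "\<beta> u a = \<beta> (sl2_smult (coeff_e u) sl2_e + sl2_smult (coeff_f u) sl2_f + sl2_smult (coeff_h u) sl2_h) a"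
      using sl2_decompose[of u] by simp
    then show ?thesis by (simp add: a1 s1 s2 tensor_def)
  qed
  ultimately show "Vector_Spaces.linear loop_scale s ?g \<and> (\<forall>u a. ?g (u \<otimes> a) = \<beta> u a)"
    by blast
  fix g assume g: "Vector_Spaces.linear loop_scale s g \<and> (\<forall>u a. g (u \<otimes> a) = \<beta> u a)"
  show "g = ?g"
  proof
    fix w
    have "g w = g (sl2_e \<otimes> coeff_e w + sl2_f \<otimes> coeff_f w + sl2_h \<otimes> coeff_h w)"
      using loop_decompose[of w] by simp
    also have "\<dots> = ?g w"
      using g by (simp add: Vector_Spaces.linear_iff)
    finally show "g w = ?g w" .
  qed
qed

definition lie_subalgebra :: "'a::field loop set \<Rightarrow> bool" where
  "lie_subalgebra S \<longleftrightarrow> loop.subspace S \<and> (\<forall>u\<in>S. \<forall>v\<in>S. \<lbrakk>u, v\<rbrakk> \<in> S)"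

text \<open>A family is a basis if it is injective and its range is a basis; injectivity is needed
  because independence of the range alone does not exclude repetitions.\<close>

definition basis_family :: "('i \<Rightarrow> 'a::field loop) \<Rightarrow> 'a loop set \<Rightarrow> bool" where
  "basis_family b V \<longleftrightarrow> inj b \<and> loop.independent (range b) \<and> loop.span (range b) = V"

definition ons_A :: "'a::field_char_0 loop" where
  "ons_A = sl2_x \<otimes> 1"

definition ons_B :: "'a::field_char_0 loop" where
  "ons_B = sl2_y \<otimes> tvar + sl2_z \<otimes> (tvar - 1)"

definition onsager :: "'a::field_char_0 loop set" where
  "onsager = lie_subalgebra hull {ons_A, ons_B}"

lemma lie_subalgebra_onsager: "lie_subalgebra onsager"
  unfolding onsager_def
proof (rule hull_in)
  fix T :: "'a loop set set"
  assume "\<forall>S\<in>T. lie_subalgebra S"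
  then show "lie_subalgebra (\<Inter>T)"
    by (auto simp: lie_subalgebra_def intro!: loop.subspace_Inter)
qed

lemma ons_A_coeffs: "ons_A = Sl2 2 0 (- 1)"
  by (simp add: ons_A_def tensor_def sl2_basis_defs sl2_defs)

lemma ons_B_coeffs: "ons_B = Sl2 0 (- 2 * tvar) (- 1)"
  by (simp add: ons_B_def tensor_def sl2_basis_defs sl2_defs algebra_simps)

lemma onsager_relations:
  "\<lbrakk>ons_A, \<lbrakk>ons_A, \<lbrakk>ons_A, ons_B\<rbrakk>\<rbrakk>\<rbrakk> = 4 *\<^sub>L \<lbrakk>ons_A, ons_B\<rbrakk>"
  "\<lbrakk>ons_B, \<lbrakk>ons_B, \<lbrakk>ons_B, ons_A\<rbrakk>\<rbrakk>\<rbrakk> = 4 *\<^sub>L \<lbrakk>ons_B, ons_A\<rbrakk>"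
  by (simp_all add: ons_A_coeffs ons_B_coeffs bracket_def loop_scale_def sl2_smult_def algebra_simps)

text \<open>Only the indices $i \ge 1$ of \<open>psi_du\<close> are meaningful.\<close>

definition A_du :: "nat \<Rightarrow> 'a::field_char_0 loop" where
  "A_du i = - (sl2_x \<otimes> (- tvar) ^ i)"

definition B_du :: "nat \<Rightarrow> 'a::field_char_0 loop" where
  "B_du i = (sl2_y \<otimes> tvar + sl2_z \<otimes> (tvar - 1)) \<cdot> (- tvar) ^ i"

definition psi_du :: "nat \<Rightarrow> 'a::field_char_0 loop" where
  "psi_du i = - (sl2_y \<otimes> (- tvar) ^ i)"

text \<open>The basis $[0321]$, enumerated in the order $A_0, B_0, \psi_1, A_1, B_1, \psi_2, \ldots$\<close>

definition basis_0321 :: "nat \<Rightarrow> 'a::field_char_0 loop" where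
  "basis_0321 k =
     (if k mod 3 = 0 then A_du (k div 3)
      else if k mod 3 = 1 then B_du (k div 3)
      else psi_du (k div 3 + 1))"

text \<open>The recursion; the value \<open>p 0\<close> is not constrained.\<close>

definition recursion_0321 ::
  "(nat \<Rightarrow> 'a::field_char_0 loop) \<Rightarrow> (nat \<Rightarrow> 'a loop) \<Rightarrow> (nat \<Rightarrow> 'a loop) \<Rightarrow> bool" where
  "recursion_0321 a b p \<longleftrightarrow>
     a 0 = - ons_A \<and> b 0 = ons_B \<and>
     (\<forall>i\<ge>1.
        p i = (1/2) *\<^sub>L a (i - 1) + (1/2) *\<^sub>L b (i - 1) - (1/4) *\<^sub>L \<lbrakk>a (i - 1), ons_B\<rbrakk> \<and>
        a i = - ((1/2) *\<^sub>L \<lbrakk>p i, ons_A\<rbrakk>) - p i \<and>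
        b i = (1/2) *\<^sub>L \<lbrakk>ons_B, p i\<rbrakk> - p i)"

end

theory Submission
  imports Defs
begin

text \<open>All structure constants of the family come from the case of zero shifts, since the bracket
  is linear over \<open>\<A>\<close>: each bracket of two members of the family is a combination of at most three
  members, so their span is a subalgebra containing \<open>A\<close> and \<open>B\<close>. The recursion is a special case
  of these bracket formulas and shows conversely that any subalgebra containing \<open>A\<close> and \<open>B\<close>
  contains the family. For independence, the \<open>e\<close>-, \<open>f\<close>- and \<open>h\<close>-coefficients are polynomials in
  \<open>t\<close>, and in the given order each new member raises one of the degree bounds: \<open>A\<^sub>i\<close> that of the
  \<open>e\<close>-coefficient, \<open>B\<^sub>i\<close> that of the \<open>f\<close>-coefficient, \<open>\<psi>\<^sub>i\<^sub>+\<^sub>1\<close> that of the \<open>h\<close>-coefficient.\<close>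

section \<open>Linear independence of a sequence from a filtration by subspaces\<close>

lemma (in vector_space) independent_range_filtration:
  fixes b :: "nat \<Rightarrow> 'b"
  assumes sub: "\<And>k. subspace (V k)"
    and mem: "\<And>j k. b j \<in> V k \<longleftrightarrow> j < k"
  shows "inj b" "independent (range b)"
proof -
  \<comment> \<open>For \<open>i < j\<close> the subspace \<open>V j\<close> contains
    \<open>b i\<close> but not \<open>b j\<close>.\<close>
  show "inj b"
    by (metis injI mem nat_neq_iff less_irrefl)
  have init: "independent (b ` {..<n})" for n
  proof (induction n)
    case (Suc n)
    \<comment> \<open>All earlier members lie in \<open>V n\<close>, and \<open>b n\<close> does
      not, so adding it keeps the set independent.\<close>
    have "span (b ` {..<n}) \<subseteq> V n"
      by (intro span_minimal sub) (auto simp: mem)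
    then have "b n \<notin> span (b ` {..<n})"
      using mem[of n n] by blast
    then show ?case
      using Suc by (simp add: lessThan_Suc independent_insertI)
  qed (simp add: independent_empty)
  \<comment> \<open>The range is the union of a chain of independent initial segments.\<close>
  have "range b = \<Union> (range (\<lambda>n. b ` {..<n}))"
    by auto
  moreover have "independent (\<Union> (range (\<lambda>n. b ` {..<n})))"
  proof (rule independent_Union_directed)
    fix c d assume "c \<in> range (\<lambda>n. b ` {..<n})" "d \<in> range (\<lambda>n. b ` {..<n})"
    then obtain m n where "c = b ` {..<m}" "d = b ` {..<n}"
      by blast
    then show "c \<subseteq> d \<or> d \<subseteq> c"
      by (cases "m \<le> n") (auto intro!: image_mono)
  qed (use init in auto)
  ultimately show "independent (range b)"
    by simp
qed

section \<open>Polynomials inside the three-point algebra\<close>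

definition tp_poly :: "'a::field poly \<Rightarrow> 'a three_point" where
  "tp_poly p = Abs_three_point (Fract p 1)"

lemma Rep_tp_poly: "Rep_three_point (tp_poly p) = Fract p 1"
  by (simp add: tp_poly_def Abs_three_point_inverse three_point_carrier_poly)

text \<open>Makes the degree of a polynomial element of \<open>\<A>\<close> well defined, so that
  membership in \<open>poly_loops\<close> can be read off from coefficients.\<close>

lemma tp_poly_inject [simp]: "tp_poly p = tp_poly q \<longleftrightarrow> p = q"
  by (simp add: Rep_tp_poly eq_fract flip: Rep_three_point_inject)

lemma tp_poly_0: "tp_poly 0 = 0"
  by (simp add: Rep_tp_poly zero_three_point.rep_eq Zero_fract_def flip: Rep_three_point_inject)

lemma tp_poly_1 [simp]: "tp_poly 1 = 1"
  by (simp add: Rep_tp_poly one_three_point.rep_eq One_fract_def flip: Rep_three_point_inject)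

lemma tp_poly_add: "tp_poly (p + q) = tp_poly p + tp_poly q"
  by (simp add: Rep_tp_poly plus_three_point.rep_eq flip: Rep_three_point_inject)

lemma tp_poly_mult: "tp_poly (p * q) = tp_poly p * tp_poly q"
  by (simp add: Rep_tp_poly times_three_point.rep_eq flip: Rep_three_point_inject)

lemma tp_poly_uminus: "tp_poly (- p) = - tp_poly p"
  by (simp add: Rep_tp_poly uminus_three_point.rep_eq flip: Rep_three_point_inject)

lemma tp_poly_smult: "tp_poly (smult c p) = tp_const c * tp_poly p"
  by (simp add: Rep_tp_poly times_three_point.rep_eq tp_const.rep_eq flip: Rep_three_point_inject)

lemma tp_poly_power: "tp_poly (p ^ n) = tp_poly p ^ n"
  by (induction n) (simp_all add: tp_poly_mult)

lemma minus_tvar_power: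
  "(- tvar :: 'a::field three_point) ^ i = tp_poly (monom ((- 1) ^ i) i)"
proof -
  have "(- tvar :: 'a three_point) = tp_poly (monom (- 1) 1)"
    by (simp add: Rep_tp_poly uminus_three_point.rep_eq tvar.rep_eq monom_altdef
        flip: Rep_three_point_inject)
  then have "(- tvar :: 'a three_point) ^ i = tp_poly (monom (- 1) 1 ^ i)"
    by (simp only: tp_poly_power)
  then show ?thesis
    by (simp add: monom_power)
qed

text \<open>The bounds are exclusive and stated by vanishing coefficients: the bound 0 then means
  the zero polynomial, and 0 satisfies every bound, which \<open>degree p < i\<close> would violate
  at \<open>i = 0\<close>.\<close>

definition poly_loops :: "nat \<Rightarrow> nat \<Rightarrow> nat \<Rightarrow> 'a::field loop set" where
  "poly_loops i j l = {Sl2 (tp_poly p) (tp_poly q) (tp_poly r) | p q r.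
     (\<forall>n\<ge>i. coeff p n = 0) \<and> (\<forall>n\<ge>j. coeff q n = 0) \<and> (\<forall>n\<ge>l. coeff r n = 0)}"

lemma Sl2_in_poly_loops [simp]:
  "Sl2 (tp_poly p) (tp_poly q) (tp_poly r) \<in> poly_loops i j l \<longleftrightarrow>
     (\<forall>n\<ge>i. coeff p n = 0) \<and> (\<forall>n\<ge>j. coeff q n = 0) \<and> (\<forall>n\<ge>l. coeff r n = 0)"
  by (auto simp: poly_loops_def)

lemma subspace_poly_loops: "loop.subspace (poly_loops i j l)"
proof (rule loop.subspaceI)
  show "0 \<in> poly_loops i j l"
    using Sl2_in_poly_loops[of 0 0 0 i j l] by (simp add: zero_sl2_def tp_poly_0)
next
  fix u v :: "'a loop" assume "u \<in> poly_loops i j l" "v \<in> poly_loops i j l"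
  then show "u + v \<in> poly_loops i j l"
    by (auto simp: poly_loops_def[of i j l] plus_sl2_def simp flip: tp_poly_add)
next
  fix c :: 'a and u :: "'a loop" assume "u \<in> poly_loops i j l"
  then show "c *\<^sub>L u \<in> poly_loops i j l"
    by (auto simp: poly_loops_def[of i j l] loop_scale_def sl2_smult_def simp flip: tp_poly_smult)
qed

section \<open>Coordinates of the family and their degrees\<close>

lemma A_du_coeffs: "A_du i = Sl2 (- 2 * (- tvar) ^ i) 0 ((- tvar) ^ i)"
  by (simp add: A_du_def tensor_def sl2_basis_defs sl2_defs)

lemma B_du_coeffs: "B_du i = Sl2 0 (2 * (- tvar) ^ Suc i) (- ((- tvar) ^ i))"
  by (simp add: B_du_def loop_act_def tensor_def sl2_basis_defs sl2_defs algebra_simps)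

lemma psi_du_coeffs: "psi_du i = Sl2 0 (2 * (- tvar) ^ i) ((- tvar) ^ i)"
  by (simp add: psi_du_def tensor_def sl2_basis_defs sl2_defs)

lemma A_du_poly:
  "A_du i = Sl2 (tp_poly (monom (- 2 * (- 1) ^ i) i)) (tp_poly 0) (tp_poly (monom ((- 1) ^ i) i))"
  unfolding A_du_coeffs minus_tvar_power smult_monom[symmetric] tp_poly_smult tp_poly_0
  by simp

lemma B_du_poly:
  "B_du i = Sl2 (tp_poly 0) (tp_poly (monom (2 * (- 1) ^ Suc i) (Suc i)))
     (tp_poly (monom (- ((- 1) ^ i)) i))"
  unfolding B_du_coeffs minus_tvar_power smult_monom[symmetric] tp_poly_smult
    minus_monom[symmetric] tp_poly_uminus tp_poly_0
  by simp

lemma psi_du_poly: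
  "psi_du i = Sl2 (tp_poly 0) (tp_poly (monom (2 * (- 1) ^ i) i)) (tp_poly (monom ((- 1) ^ i) i))"
  unfolding psi_du_coeffs minus_tvar_power smult_monom[symmetric] tp_poly_smult tp_poly_0
  by simp

lemma coeff_monom_bounded_iff: "(\<forall>n\<ge>k. coeff (monom c m) n = 0) \<longleftrightarrow> c = 0 \<or> m < k"
  by (metis coeff_monom leD le_less_linear)

lemma div_3_less_iffs:
  fixes j k :: nat
  shows "j < (k + 2) div 3 \<longleftrightarrow> 3 * j < k" "Suc j < (k + 1) div 3 + 1 \<longleftrightarrow> 3 * j + 1 < k"
    "j < k div 3 + 1 \<longleftrightarrow> 3 * j \<le> k"
  by presburger+

lemma basis_0321_simps:
  "basis_0321 (3 * i) = A_du i"
  "basis_0321 (3 * i + 1) = B_du i"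
  "basis_0321 (3 * i + 2) = psi_du (Suc i)"
proof -
  have "(3 * i + 1) div 3 = i" "(3 * i + 1) mod 3 = 1" "(3 * i + 2) div 3 = i" "(3 * i + 2) mod 3 = 2"
    by presburger+
  then show "basis_0321 (3 * i) = A_du i" "basis_0321 (3 * i + 1) = B_du i"
    "basis_0321 (3 * i + 2) = psi_du (Suc i)"
    unfolding basis_0321_def by simp_all
qed

lemma mod_3_exhaust:
  fixes k :: nat
  obtains i where "k = 3 * i" | i where "k = 3 * i + 1" | i where "k = 3 * i + 2"
proof -
  have "\<exists>i. k = 3 * i \<or> k = 3 * i + 1 \<or> k = 3 * i + 2"
    by presburger
  then show thesis
    using that by blast
qed

text \<open>Among the first \<open>k\<close> members there are \<open>(k + 2) div 3\<close> of type
  \<open>A\<close>, \<open>(k + 1) div 3\<close> of type \<open>B\<close> and \<open>k div 3\<close>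
  of type \<open>\<psi>\<close>. The last two bounds are one larger because \<open>B\<^sub>j\<close>
  has \<open>f\<close>-degree \<open>j + 1\<close> and \<open>\<psi>\<^sub>j\<^sub>+\<^sub>1\<close>
  has \<open>h\<close>-degree \<open>j + 1\<close>. The other coefficients impose only weaker
  conditions, and the leading coefficients 2 and -2 are nonzero in characteristic zero.\<close>

lemma basis_0321_in_poly_loops_iff:
  "basis_0321 j \<in> poly_loops ((k + 2) div 3) ((k + 1) div 3 + 1) (k div 3 + 1) \<longleftrightarrow> j < k"
proof (cases j rule: mod_3_exhaust)
  case (1 i)
  show ?thesis
    unfolding 1 basis_0321_simps A_du_poly Sl2_in_poly_loops coeff_monom_bounded_iff div_3_less_iffs
    by auto
next
  case (2 i)
  show ?thesis
    unfolding 2 basis_0321_simps B_du_poly Sl2_in_poly_loops coeff_monom_bounded_iff div_3_less_iffs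
    by auto
next
  case (3 i)
  show ?thesis
    unfolding 3 basis_0321_simps psi_du_poly Sl2_in_poly_loops coeff_monom_bounded_iff div_3_less_iffs
    by auto
qed

lemma range_basis_0321:
  "range basis_0321 = range A_du \<union> range B_du \<union> range (\<lambda>i. psi_du (Suc i))"
proof
  show "range basis_0321 \<subseteq> range A_du \<union> range B_du \<union> range (\<lambda>i. psi_du (Suc i))"
  proof (intro image_subsetI)
    fix k show "basis_0321 k \<in> range A_du \<union> range B_du \<union> range (\<lambda>i. psi_du (Suc i))"
      by (cases k rule: mod_3_exhaust) (use basis_0321_simps in blast)+
  qed
  show "range A_du \<union> range B_du \<union> range (\<lambda>i. psi_du (Suc i)) \<subseteq> range basis_0321"
    by (intro Un_least image_subsetI) (metis basis_0321_simps rangeI)+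
qed

section \<open>Structure constants of the family\<close>

lemma bracket_A_du_A_du: "\<lbrakk>A_du i, A_du j\<rbrakk> = 0"
  by (simp add: A_du_coeffs bracket_def zero_sl2_def)

lemma bracket_B_du_B_du: "\<lbrakk>B_du i, B_du j\<rbrakk> = 0"
  by (simp add: B_du_coeffs bracket_def zero_sl2_def algebra_simps)

lemma bracket_psi_du_psi_du: "\<lbrakk>psi_du i, psi_du j\<rbrakk> = 0"
  by (simp add: psi_du_coeffs bracket_def zero_sl2_def)

text \<open>At zero shifts this is \<open>[x, B] = 2x - 2B + 4y \<otimes> t\<close> with
  \<open>A\<^sub>0 = -x\<close> and \<open>\<psi>\<^sub>1 = y \<otimes> t\<close>; the factor
  \<open>t\<close> at \<open>y\<close> accounts for the extra 1 in the index.\<close>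

lemma bracket_A_du_B_du:
  "\<lbrakk>A_du i, B_du j\<rbrakk> = 2 *\<^sub>L A_du (i + j) + 2 *\<^sub>L B_du (i + j) - 4 *\<^sub>L psi_du (i + j + 1)"
  by (simp add: A_du_coeffs B_du_coeffs psi_du_coeffs bracket_def loop_scale_def sl2_smult_def
      sl2_defs power_add algebra_simps)

lemma bracket_psi_du_A_du: "\<lbrakk>psi_du i, A_du j\<rbrakk> = 2 *\<^sub>L A_du (i + j) + 2 *\<^sub>L psi_du (i + j)"
  by (simp add: A_du_coeffs psi_du_coeffs bracket_def loop_scale_def sl2_smult_def
      sl2_defs power_add algebra_simps)

lemma bracket_B_du_psi_du: "\<lbrakk>B_du i, psi_du j\<rbrakk> = 2 *\<^sub>L B_du (i + j) + 2 *\<^sub>L psi_du (i + j)"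
  by (simp add: B_du_coeffs psi_du_coeffs bracket_def loop_scale_def sl2_smult_def
      sl2_defs power_add algebra_simps)

lemma bracket_antisym: "\<lbrakk>u, v\<rbrakk> = - \<lbrakk>v, u\<rbrakk>"
  by (simp add: bracket_def sl2_defs algebra_simps)

lemma bracket_minus_right: "\<lbrakk>u, - v\<rbrakk> = - \<lbrakk>u, v\<rbrakk>"
  by (simp add: bracket_def sl2_defs algebra_simps)

lemma ons_A_eq_A_du: "ons_A = - A_du 0"
  by (simp add: ons_A_def A_du_def)

lemma ons_B_eq_B_du: "ons_B = B_du 0"
  by (simp add: ons_B_def B_du_def loop_act_def)

section \<open>Closure of the span under the bracket\<close>

lemma lie_subalgebra_span:
  assumes "\<And>u v. u \<in> S \<Longrightarrow> v \<in> S \<Longrightarrow> \<lbrakk>u, v\<rbrakk> \<in> loop.span S"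
  shows "lie_subalgebra (loop.span S)"
proof -
  interpret L: Vector_Spaces.linear loop_scale loop_scale "\<lambda>u. \<lbrakk>u, v\<rbrakk>" for v :: "'a loop"
    by (rule bracket_linear)
  interpret R: Vector_Spaces.linear loop_scale loop_scale "\<lambda>v. \<lbrakk>u, v\<rbrakk>" for u :: "'a loop"
    by (rule bracket_linear)
  \<comment> \<open>Bilinearity is used one argument at a time: first the second argument runs
    through the span while the first is a generator, then the first argument does.\<close>
  have gen: "\<lbrakk>u, v\<rbrakk> \<in> loop.span S" if "u \<in> S" "v \<in> loop.span S" for u v
    using that(2,1)
    by (induction rule: loop.span_induct_alt)
       (auto simp: R.zero R.add R.scale intro: loop.span_zero loop.span_add loop.span_scale assms)
  have "\<lbrakk>u, v\<rbrakk> \<in> loop.span S" if "u \<in> loop.span S" "v \<in> loop.span S" for u v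
    using that
    by (induction rule: loop.span_induct_alt)
       (auto simp: L.zero L.add L.scale intro: loop.span_zero loop.span_add loop.span_scale gen)
  then show ?thesis
    by (simp add: lie_subalgebra_def loop.subspace_span)
qed

lemma lie_subalgebra_span_basis_0321: "lie_subalgebra (loop.span (range basis_0321))"
proof (rule lie_subalgebra_span)
  let ?W = "loop.span (range basis_0321)"
  have A: "A_du i \<in> ?W" and B: "B_du i \<in> ?W" for i
    by (auto intro!: loop.span_base simp: range_basis_0321)
  have P: "psi_du (Suc i) \<in> ?W" for i
    by (auto intro!: loop.span_base simp: range_basis_0321)
  note closed = loop.span_zero loop.span_add loop.span_diff loop.span_neg loop.span_scale A B P
  \<comment> \<open>The family contains \<open>psi_du\<close> at positive indices only, so indices
    are rewritten to the form \<open>Suc _\<close>.\<close>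
  have AB: "\<lbrakk>A_du i, B_du j\<rbrakk> \<in> ?W" for i j
    unfolding bracket_A_du_B_du Suc_eq_plus1[symmetric] by (intro closed)
  have PA: "\<lbrakk>psi_du (Suc i), A_du j\<rbrakk> \<in> ?W" and BP: "\<lbrakk>B_du j, psi_du (Suc i)\<rbrakk> \<in> ?W" for i j
    unfolding bracket_psi_du_A_du bracket_B_du_psi_du add_Suc add_Suc_right by (intro closed)+
  have neg: "\<lbrakk>u, v\<rbrakk> \<in> ?W" if "\<lbrakk>v, u\<rbrakk> \<in> ?W" for u v
    using loop.span_neg[OF that] bracket_antisym[of u v] by simp
  fix u v :: "'a loop" assume "u \<in> range basis_0321" "v \<in> range basis_0321"
  then have "u \<in> range A_du \<union> range B_du \<union> range (\<lambda>i. psi_du (Suc i))"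
      "v \<in> range A_du \<union> range B_du \<union> range (\<lambda>i. psi_du (Suc i))"
    by (simp_all only: range_basis_0321)
  then show "\<lbrakk>u, v\<rbrakk> \<in> ?W"
    by (auto simp: bracket_A_du_A_du bracket_B_du_B_du bracket_psi_du_psi_du
        intro: loop.span_zero AB PA BP neg[OF AB] neg[OF PA] neg[OF BP])
qed

section \<open>The recursion: validity, uniqueness and membership in subalgebras\<close>

lemma recursion_0321_du: "recursion_0321 A_du B_du psi_du"
  unfolding recursion_0321_def
proof (intro conjI allI impI)
  show "A_du 0 = - ons_A" "B_du 0 = ons_B"
    by (simp_all add: ons_A_eq_A_du ons_B_eq_B_du)
next
  \<comment> \<open>Each equation is a bracket formula with one index 0, solved for the new
    member.\<close>
  fix i :: nat assume i: "i \<ge> 1"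
  show "psi_du i = (1/2) *\<^sub>L A_du (i - 1) + (1/2) *\<^sub>L B_du (i - 1) - (1/4) *\<^sub>L \<lbrakk>A_du (i - 1), ons_B\<rbrakk>"
    using i by (simp add: ons_B_eq_B_du bracket_A_du_B_du loop.scale_right_distrib
        loop.scale_right_diff_distrib)
  show "A_du i = - ((1/2) *\<^sub>L \<lbrakk>psi_du i, ons_A\<rbrakk>) - psi_du i"
    by (simp add: ons_A_eq_A_du bracket_minus_right bracket_psi_du_A_du loop.scale_right_distrib
        loop.scale_right_diff_distrib)
  show "B_du i = (1/2) *\<^sub>L \<lbrakk>ons_B, psi_du i\<rbrakk> - psi_du i"
    by (simp add: ons_B_eq_B_du bracket_B_du_psi_du loop.scale_right_distrib)
qed

lemma recursion_0321_step:
  assumes "recursion_0321 a b p"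
  shows "p (Suc i) = (1/2) *\<^sub>L a i + (1/2) *\<^sub>L b i - (1/4) *\<^sub>L \<lbrakk>a i, ons_B\<rbrakk>"
    and "a (Suc i) = - ((1/2) *\<^sub>L \<lbrakk>p (Suc i), ons_A\<rbrakk>) - p (Suc i)"
    and "b (Suc i) = (1/2) *\<^sub>L \<lbrakk>ons_B, p (Suc i)\<rbrakk> - p (Suc i)"
  using assms by (simp_all add: recursion_0321_def)

text \<open>The values \<open>a i\<close> and \<open>b i\<close> determine \<open>p (Suc i)\<close>,
  which determines \<open>a (Suc i)\<close> and \<open>b (Suc i)\<close>; hence the induction
  carries only \<open>a\<close> and \<open>b\<close>.\<close>

lemma recursion_0321_unique:
  assumes "recursion_0321 a b p" "recursion_0321 a' b' p'"
  shows "a i = a' i \<and> b i = b' i \<and> p (Suc i) = p' (Suc i)"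
proof -
  have "a i = a' i \<and> b i = b' i"
  proof (induction i)
    case 0
    show ?case
      using assms by (simp add: recursion_0321_def)
  next
    case (Suc i)
    then show ?case
      by (simp only: recursion_0321_step[OF assms(1)] recursion_0321_step[OF assms(2)])
  qed
  then show ?thesis
    by (simp only: recursion_0321_step(1)[OF assms(1)] recursion_0321_step(1)[OF assms(2)])
qed

text \<open>Every step uses only linear combinations and brackets with \<open>ons_A\<close> or
  \<open>ons_B\<close>. Applied to the closed forms, this puts the family into
  \<open>onsager\<close>.\<close>

lemma recursion_0321_mem:
  assumes rec: "recursion_0321 a b p" and S: "lie_subalgebra S" "ons_A \<in> S" "ons_B \<in> S"
  shows "a i \<in> S \<and> b i \<in> S \<and> p (Suc i) \<in> S"
proof -
  have sub: "loop.subspace S" and br: "\<And>u v. u \<in> S \<Longrightarrow> v \<in> S \<Longrightarrow> \<lbrakk>u, v\<rbrakk> \<in> S"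
    using S(1) by (auto simp: lie_subalgebra_def)
  note closed = br loop.subspace_add[OF sub] loop.subspace_diff[OF sub] loop.subspace_neg[OF sub]
    loop.subspace_scale[OF sub]
  have p: "p (Suc i) \<in> S" if "a i \<in> S" "b i \<in> S" for i
    unfolding recursion_0321_step(1)[OF rec] by (intro closed S that)
  have "a i \<in> S \<and> b i \<in> S"
  proof (induction i)
    case 0
    show ?case
      using rec closed S by (simp add: recursion_0321_def)
  next
    case (Suc i)
    then have "p (Suc i) \<in> S"
      using p by blast
    then show ?case
      unfolding recursion_0321_step(2,3)[OF rec] by (intro conjI closed S)
  qed
  then show ?thesis
    using p by blast
qed

section \<open>The Onsager algebra as the span of the family\<close>

lemma onsager_minimal:
  assumes "lie_subalgebra S" "ons_A \<in> S" "ons_B \<in> S"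
  shows "onsager \<subseteq> S"
  unfolding onsager_def using assms by (intro hull_minimal) auto

lemma span_basis_0321: "loop.span (range basis_0321) = (onsager :: 'a::field_char_0 loop set)"
proof
  let ?O = "onsager :: 'a loop set"
  have "ons_A \<in> ?O" "ons_B \<in> ?O"
    by (simp_all add: onsager_def hull_inc)
  then have "A_du i \<in> ?O \<and> B_du i \<in> ?O \<and> psi_du (Suc i) \<in> ?O" for i
    by (rule recursion_0321_mem[OF recursion_0321_du lie_subalgebra_onsager])
  then have "range basis_0321 \<subseteq> ?O"
    by (auto simp: range_basis_0321)
  then show "loop.span (range basis_0321) \<subseteq> ?O"
    using lie_subalgebra_onsager by (intro loop.span_minimal) (auto simp: lie_subalgebra_def)
next
  let ?b = "basis_0321 :: nat \<Rightarrow> 'a loop"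
  have "A_du 0 \<in> range ?b" "B_du 0 \<in> range ?b"
    by (auto simp: range_basis_0321)
  then show "onsager \<subseteq> loop.span (range ?b)"
    by (intro onsager_minimal lie_subalgebra_span_basis_0321)
       (auto simp: ons_A_eq_A_du ons_B_eq_B_du intro: loop.span_neg loop.span_base)
qed

theorem corollary8p5:
  shows "basis_family basis_0321 (onsager :: 'a::field_char_0 loop set) \<and>
    recursion_0321 (A_du :: nat \<Rightarrow> 'a loop) B_du psi_du \<and>
    (\<forall>a b p :: nat \<Rightarrow> 'a loop. recursion_0321 a b p \<longrightarrow>
       (\<forall>i. a i = A_du i \<and> b i = B_du i \<and> p (i + 1) = psi_du (i + 1)))"
proof (intro conjI)
  show "basis_family basis_0321 (onsager :: 'a loop set)"
    unfolding basis_family_def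
    \<comment> \<open>The filtration consists of the \<open>poly_loops\<close> whose bounds admit
      exactly the first \<open>k\<close> members.\<close>
    using loop.independent_range_filtration[OF subspace_poly_loops basis_0321_in_poly_loops_iff]
      span_basis_0321 by blast
  show "recursion_0321 (A_du :: nat \<Rightarrow> 'a loop) B_du psi_du"
    by (rule recursion_0321_du)
  show "\<forall>a b p :: nat \<Rightarrow> 'a loop. recursion_0321 a b p \<longrightarrow>
       (\<forall>i. a i = A_du i \<and> b i = B_du i \<and> p (i + 1) = psi_du (i + 1))"
    unfolding Suc_eq_plus1[symmetric] using recursion_0321_unique[OF _ recursion_0321_du] by blast
qed

end
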